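(* Let $V=\{1,\dots,n\}$ and let $\mathcal{P}_+$ be a set of probability distributions of random symmetric matrices $\tilde W=[\tilde w_{ij}]$ supported on $\Xi\subseteq\mathbb{R}^{n\times n}_+$. Let $$\mathrm{Val(DRP)}=\tfrac12\max_{y\in\{-1,1\}^{n}}\min_{\mathbb{P}_W\in\mathcal{P}_+}\mathbb{E}_{\mathbb{P}_W}\Big[\sum_{i<j}\tilde w_{ij}(1-y_iy_j)\Big].$$ Consider the following randomized algorithm. (1) Compute an optimal solution $\hat Y$ of $$\max_{Y\succeq0,\ Y_{ii}=1\ \forall i}\ \min_{\mathbb{P}_W\in\mathcal{P}_+}\ \tfrac14\mathbb{E}_{\mathbb{P}_W}\big[\langle\tilde W,\mathbf{1}-Y\rangle\big]$$ (with $\mathbf{1}$ the all-ones matrix and $\langle A,B\rangle=\sum_{i,j}A_{ij}B_{ij}$), together with a worst-case distribution $\mathbb{P}_{\hat W}\in\arg\min_{\mathbb{P}_W\in\mathcal{P}_+}\mathbb{E}_{\mathbb{P}_W}[\langle\tilde W,\mathbf{1}-\hat Y\rangle]$. (2) Factor $\hat Y=U^TU$ and let $\hat u_i\in S_n$ be the $i$-th column of $U$. (3) Draw $r$ from the uniform distribution $\mathbb{U}$ on the unit sphere $S_n=\{u\in\mathbb{R}^n:\|u\|=1\}$, independently of $\tilde W$. (4) Set $\hat y_i=1$ if $\hat u_i\cdot r\ge0$ and $\hat y_i=-1$ otherwise. For $W\in\Xi$ let $\hat C(W)=\sum_{i<j}w_{ij}\frac{1-\hat y_i\hat y_j}{2}$.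 Then $$\mathbb{E}_{\mathbb{P}_W}\big[\mathbb{E}_{\mathbb{U}}[\hat C(W)]\big]\ \ge\ 0.878\cdot\mathrm{Val(DRP)}\quad\text{for all }\mathbb{P}_W\in\mathcal{P}_+;$$ in particular $\mathbb{E}_{\mathbb{P}_{\hat W}}[\mathbb{E}_{\mathbb{U}}[\hat C(W)]]\ge0.878\cdot\mathrm{Val(DRP)}$. Moreover, $\mathrm{Val(DRP)}\ge\mathbb{E}_{\hat{\mathbb{P}}'_W}[\mathbb{E}_{\mathbb{U}}[\hat C(W)]]$, where $\hat{\mathbb{P}}'_W\in\arg\min_{\mathbb{P}_W\in\mathcal{P}_+}\mathbb{E}_{\mathbb{P}_W}\big[\sum_{i<j}\tilde w_{ij}\frac{1-\hat y_i\hat y_j}{2}\big]$.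
   Context: This is the Goemans–Williamson randomized rounding algorithm applied to the distributionally robust max-cut problem. Standing assumptions: the problems are well-posed with finite optimal values, inner minimizations attain their minima, and all expectations are well-defined.
   Formalization: In the last claim the minimizing distribution is chosen for each realized cut, so it depends on r, and the expectation over r is taken outside: Val(DRP) ≥ E_U[E_{P̂'(r)}[Ĉ(W)]]; with one fixed P̂' and E_U inside, the claim fails (three point masses on the edges of a triangle). *)

theory Defs
  imports "HOL-Probability.Probability"
begin

text \<open>
  The vertex set \<open>{1,\<dots>,n}\<close> is a finite well-ordered index type, so that \<open>i < j\<close> makes sense.
  \<open>\<Xi>\<close> need not be measurable: \<open>AE\<close> asks for a null set covering its complement.
\<close>

definition random_matrix_law :: "(real^'n^'n) set \<Rightarrow> (real^'n^'n) measure \<Rightarrow> bool" where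
  "random_matrix_law \<Xi> P \<longleftrightarrow>
     prob_space P \<and> sets P = sets borel \<and> (AE W in P. W \<in> \<Xi> \<and> transpose W = W)"

definition cut_vectors :: "(real^'n) set" where
  "cut_vectors = {y. \<forall>i. y $ i \<in> {-1, 1}}"

definition cut_sum :: "real^'n::{finite,wellorder} \<Rightarrow> real^'n::_^'n::_ \<Rightarrow> real" where
  "cut_sum y W = (\<Sum>i\<in>UNIV. \<Sum>j | i < j. W $ i $ j * (1 - y $ i * y $ j))"

definition cut_value :: "real^'n::{finite,wellorder} \<Rightarrow> real^'n::_^'n::_ \<Rightarrow> real" where
  "cut_value y W = (\<Sum>i\<in>UNIV. \<Sum>j | i < j. W $ i $ j * ((1 - y $ i * y $ j) / 2))"

text \<open>
  The infimum over \<open>\<P>\<close> is a minimum exactly when it is attained; attainment is a separate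
  hypothesis wherever these values are used.
\<close>

definition drp_value :: "(real^'n::{finite,wellorder}^'n::_) measure set \<Rightarrow> real" where
  "drp_value \<P> = 1/2 * (MAX y\<in>cut_vectors. INF P\<in>\<P>. \<integral>W. cut_sum y W \<partial>P)"

definition psd :: "real^'n^'n \<Rightarrow> bool" where
  "psd Y \<longleftrightarrow> transpose Y = Y \<and> (\<forall>x. 0 \<le> x \<bullet> (Y *v x))"

definition elliptope :: "(real^'n^'n) set" where
  "elliptope = {Y. psd Y \<and> (\<forall>i. Y $ i $ i = 1)}"

text \<open>
  The inner product of \<open>real^'n^'n\<close> is the entrywise (Frobenius) one, and \<open>\<chi> i j. 1\<close> is the
  all-ones matrix, not the identity.
\<close>

definition sdp_integrand :: "real^'n^'n \<Rightarrow> real^'n^'n \<Rightarrow> real" where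
  "sdp_integrand Y W = W \<bullet> ((\<chi> i j. 1) - Y)"

definition sdp_value :: "(real^'n^'n) measure set \<Rightarrow> real^'n^'n \<Rightarrow> real" where
  "sdp_value \<P> Y = (INF P\<in>\<P>. 1/4 * (\<integral>W. sdp_integrand Y W \<partial>P))"

text \<open>
  The uniform distribution on the unit sphere, as the image of the uniform distribution on the
  unit ball under the radial projection \<open>sgn x = x /\<^sub>R norm x\<close>. The origin, which \<open>sgn\<close> fixes,
  is a null set; restricting the image to the sphere discards it.
\<close>

definition sphere_uniform :: "(real^'n) measure" where
  "sphere_uniform =
     restrict_space (distr (uniform_measure lborel (ball 0 1)) borel sgn) (sphere 0 1)"

definition gw_round :: "real^'n^'n \<Rightarrow> real^'n \<Rightarrow> real^'n" where
  "gw_round U r = (\<chi> i. if 0 \<le> column i U \<bullet> r then 1 else - 1)"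

lemma space_sphere_uniform: "space (sphere_uniform :: (real^'n) measure) = sphere 0 1"
  by (simp add: sphere_uniform_def space_restrict_space)

lemma sets_sphere_uniform:
  "sets (sphere_uniform :: (real^'n) measure) = sets (restrict_space borel (sphere 0 1))"
  by (simp add: sphere_uniform_def sets_restrict_space)

lemma emeasure_unit_ball_nonzero_finite:
  "emeasure lborel (ball (0::real^'n) 1) \<noteq> 0" "emeasure lborel (ball (0::real^'n) 1) \<noteq> \<infinity>"
proof -
  have "measure lebesgue (ball (0::real^'n) 1) > 0"
    by (simp add: content_ball_pos)
  then have "measure lborel (ball (0::real^'n) 1) > 0" by simp
  then show "emeasure lborel (ball (0::real^'n) 1) \<noteq> 0"
    by (auto simp: measure_def)
  show "emeasure lborel (ball (0::real^'n) 1) \<noteq> \<infinity>"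
    using emeasure_lborel_ball_finite[of "0::real^'n" 1] by auto
qed

lemma prob_space_sphere_uniform: "prob_space (sphere_uniform :: (real^'n) measure)"
proof -
  let ?M = "uniform_measure lborel (ball 0 1) :: (real^'n) measure"
  interpret M: prob_space ?M
    by (rule prob_space_uniform_measure) (use emeasure_unit_ball_nonzero_finite in auto)
  interpret D: prob_space "distr ?M borel (sgn :: real^'n \<Rightarrow> _)"
    by (rule M.prob_space_distr) simp
  have "AE x in lborel. x \<in> ball (0::real^'n) 1 \<longrightarrow> x \<noteq> 0"
    using AE_lborel_singleton[of "0::real^'n"] by eventually_elim simp
  then have "AE x in ?M. x \<noteq> 0"
    by (intro AE_uniform_measureI) auto
  then have "AE x in ?M. sgn x \<in> sphere 0 1"
    by eventually_elim (simp add: norm_sgn)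
  then have "AE x in distr ?M borel sgn. x \<in> sphere 0 1"
    by (subst AE_distr_iff) (auto simp: sphere_def)
  then have "emeasure (distr ?M borel sgn) (sphere 0 1) = 1"
    by (intro D.emeasure_eq_1_AE) auto
  then show ?thesis
    unfolding sphere_uniform_def
    by (intro prob_spaceI) (simp add: space_restrict_space emeasure_restrict_space)
qed

lemma distr_lborel_orthogonal:
  fixes f :: "real^'n::{finite,wellorder} \<Rightarrow> real^'n::_"
  assumes f: "orthogonal_transformation f"
  shows "distr lborel borel f = lborel"
proof (rule lborel_eqI[symmetric])
  have meas: "f \<in> borel_measurable borel"
    using f by (intro borel_measurable_continuous_onI linear_continuous_on)
      (simp add: orthogonal_transformation_linear linear_linear)
  fix l u :: "real^'n::_" assume "\<And>b. b \<in> Basis \<Longrightarrow> l \<bullet> b \<le> u \<bullet> b"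
  then have content: "emeasure lborel (box l u) = (\<Prod>b\<in>Basis. (u - l) \<bullet> b)"
    by (rule emeasure_lborel_box)
  define g where "g = inv f"
  have g: "orthogonal_transformation g"
    unfolding g_def by (rule orthogonal_transformation_inv[OF f])
  have vim: "f -` A = g ` A" for A
    unfolding g_def using orthogonal_transformation_bij[OF f] by (rule bij_vimage_eq_inv_image)
  have box: "box l u \<in> lmeasurable" by simp
  have vimb: "f -` box l u \<in> sets borel"
    using measurable_sets[OF meas, of "box l u"] by simp
  have "emeasure (distr lborel borel f) (box l u) = emeasure lborel (f -` box l u)"
    using meas by (subst emeasure_distr) auto
  also have "\<dots> = emeasure lebesgue (g ` box l u)"
    using vimb unfolding vim by simp
  also have "\<dots> = ennreal (measure lebesgue (g ` box l u))"
    using measurable_orthogonal_image[OF g box] by (simp add: emeasure_eq_measure2)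
  also have "\<dots> = ennreal (measure lebesgue (box l u))"
    using measure_orthogonal_image[OF g box] by simp
  also have "\<dots> = emeasure lebesgue (box l u)"
    using box by (simp only: emeasure_eq_measure2)
  also have "\<dots> = emeasure lborel (box l u)" by simp
  finally show "emeasure (distr lborel borel f) (box l u) = (\<Prod>b\<in>Basis. (u - l) \<bullet> b)"
    using content by simp
qed simp

text \<open>
  Rotation invariance, which characterises the uniform distribution on the sphere.
\<close>

lemma distr_sphere_uniform_orthogonal:
  fixes f :: "real^'n::{finite,wellorder} \<Rightarrow> real^'n::_"
  assumes f: "orthogonal_transformation f"
  shows "distr sphere_uniform sphere_uniform f = sphere_uniform"
proof (rule measure_eqI)
  let ?M = "uniform_measure lborel (ball 0 1) :: (real^'n::_) measure"
  have meas[measurable]: "f \<in> borel_measurable borel"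
    using f by (intro borel_measurable_continuous_onI linear_continuous_on)
      (simp add: orthogonal_transformation_linear linear_linear)
  have nf: "norm (f x) = norm x" for x
    using f by (simp add: orthogonal_transformation)
  have sgnf: "sgn (f x) = f (sgn x)" for x
    using orthogonal_transformation_linear[OF f] by (simp add: sgn_div_norm nf linear_cmul)
  have fS: "f \<in> measurable sphere_uniform sphere_uniform"
    unfolding measurable_cong_sets[OF sets_sphere_uniform sets_sphere_uniform]
    by (intro measurable_restrict_space2 measurable_restrict_space1)
      (auto simp: space_restrict_space nf)
  fix A assume "A \<in> sets (distr sphere_uniform sphere_uniform f)"
  then have A: "A \<in> sets (restrict_space borel (sphere 0 1))"
    by (simp add: sets_sphere_uniform)
  then have AS: "A \<subseteq> sphere 0 1" and AB[measurable]: "A \<in> sets borel"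
    by (auto simp: sets_restrict_space_iff)
  have fA: "f -` A \<subseteq> sphere 0 1"
    using AS by (auto simp: nf subset_iff)
  have fAB[measurable]: "f -` A \<in> sets borel"
    using measurable_sets[OF meas AB] by simp
  have E: "emeasure sphere_uniform B = emeasure lborel (ball 0 1 \<inter> sgn -` B) / emeasure lborel (ball (0::real^'n::_) 1)"
    if "B \<subseteq> sphere 0 1" and [measurable]: "B \<in> sets borel" for B :: "(real^'n::_) set"
  proof -
    have [measurable]: "sgn -` B \<in> sets borel"
      using measurable_sets[OF borel_measurable_sgn that(2)] by simp
    show ?thesis
      unfolding sphere_uniform_def using that
      by (simp add: emeasure_restrict_space emeasure_distr)
  qed
  have [measurable]: "sgn -` A \<in> sets borel"
    using measurable_sets[OF borel_measurable_sgn AB] by simp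
  have "emeasure (distr sphere_uniform sphere_uniform f) A = emeasure sphere_uniform (f -` A)"
    using A fA by (subst emeasure_distr[OF fS])
      (auto simp: sets_sphere_uniform space_sphere_uniform Int_absorb2)
  also have "\<dots> = emeasure lborel (ball 0 1 \<inter> sgn -` f -` A) / emeasure lborel (ball (0::real^'n::_) 1)"
    by (rule E[OF fA fAB])
  also have "ball 0 1 \<inter> sgn -` f -` A = f -` (ball 0 1 \<inter> sgn -` A)"
    by (auto simp: nf sgnf)
  also have "emeasure lborel \<dots> = emeasure (distr lborel borel f) (ball 0 1 \<inter> sgn -` A)"
    by (subst emeasure_distr) auto
  also have "\<dots> = emeasure lborel (ball 0 1 \<inter> sgn -` A)"
    by (simp add: distr_lborel_orthogonal[OF f])
  also have "\<dots> / emeasure lborel (ball (0::real^'n::_) 1) = emeasure sphere_uniform A"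
    by (rule E[OF AS AB, symmetric])
  finally show "emeasure (distr sphere_uniform sphere_uniform f) A = emeasure sphere_uniform A" .
qed simp

end

theory Submission
  imports Defs
begin

text \<open>
  Two unit vectors at angle \<open>t\<close> are separated by a uniformly random hyperplane through the origin
  with probability \<open>t / pi\<close>: by rotation invariance this probability depends on \<open>t\<close> only, it is
  additive along arcs shorter than a half circle, and it is \<open>1 / 2\<close> at a right angle; monotonicity
  extends linearity from rational multiples of \<open>pi\<close> to all angles. Since
  \<open>t / pi \<ge> 0.878 * (1 - cos t) / 2\<close> and the weights are nonnegative, the expected rounded cut under
  every \<open>P\<close> is at least \<open>0.878\<close> times the SDP objective under \<open>P\<close>, hence at least \<open>0.878\<close> times the
  optimal worst-case SDP value. The latter dominates the value of the max-cut problem because a cut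
  vector \<open>y\<close> yields the feasible matrix \<open>y y\<^sup>T\<close> with the same objective. The upper bound holds
  pointwise in \<open>r\<close>, as every rounded vector is a cut vector.
\<close>

subsection \<open>Separation by a random hyperplane\<close>

text \<open>For orthonormal \<open>a\<close> and \<open>b\<close>, the rotation by \<open>t\<close>
  from \<open>a\<close> towards \<open>b\<close> that fixes the orthogonal complement of their
  plane. Writing it as \<open>x\<close> plus a correction avoids completing \<open>a\<close>,
  \<open>b\<close> to a basis.\<close>

definition plane_rotation :: "'a::real_inner \<Rightarrow> 'a \<Rightarrow> real \<Rightarrow> 'a \<Rightarrow> 'a" where
  "plane_rotation a b t x = x
     + ((cos t - 1) * (a \<bullet> x) - sin t * (b \<bullet> x)) *\<^sub>R a
     + (sin t * (a \<bullet> x) + (cos t - 1) * (b \<bullet> x)) *\<^sub>R b"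

definition circle_point :: "'a::real_inner \<Rightarrow> 'a \<Rightarrow> real \<Rightarrow> 'a" where
  "circle_point a b t = cos t *\<^sub>R a + sin t *\<^sub>R b"

text \<open>The sign test is that of \<open>gw_round\<close>, ties included, so for two columns of
  \<open>U\<close> this is the probability that the rounding cuts the pair.\<close>

definition separation :: "real^'n \<Rightarrow> real^'n \<Rightarrow> real" where
  "separation u v = measure sphere_uniform
     {r \<in> space sphere_uniform. (0 \<le> u \<bullet> r) \<noteq> (0 \<le> v \<bullet> r)}"

text \<open>The adjoint of the rotation by \<open>t\<close> is the rotation by \<open>-t\<close>,
  hence the angle \<open>s - t\<close>.\<close>

lemma circle_point_inner_plane_rotation:
  assumes "a \<bullet> a = 1" "b \<bullet> b = 1" "a \<bullet> b = 0"
  shows "circle_point a b s \<bullet> plane_rotation a b t x = circle_point a b (s - t) \<bullet> x"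
proof -
  have ba: "b \<bullet> a = 0" using assms(3) by (simp add: inner_commute)
  show ?thesis
    by (simp add: circle_point_def plane_rotation_def inner_simps assms ba cos_diff sin_diff)
      (simp add: algebra_simps)
qed

text \<open>Only the components \<open>A\<close>, \<open>B\<close> along \<open>a\<close>,
  \<open>b\<close> change, and the squared norm changes by (sin^2 + cos^2 - 1) (A^2 + B^2) =
  0.\<close>

lemma orthogonal_transformation_plane_rotation:
  assumes "a \<bullet> a = 1" "b \<bullet> b = 1" "a \<bullet> b = 0"
  shows "orthogonal_transformation (plane_rotation a b t)"
proof -
  have lin: "linear (plane_rotation a b t)"
    by (rule linearI) (simp_all add: plane_rotation_def inner_simps algebra_simps)
  have ba: "b \<bullet> a = 0" using assms(3) by (simp add: inner_commute)
  have "norm (plane_rotation a b t x) = norm x" for x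
  proof -
    define A B where "A = a \<bullet> x" and "B = b \<bullet> x"
    define p q where "p = (cos t - 1) * A - sin t * B" and "q = sin t * A + (cos t - 1) * B"
    have sq: "sin t * sin t + cos t * cos t - 1 = 0"
      using sin_cos_squared_add[of t] by (simp add: power2_eq_square)
    have comm: "x \<bullet> a = A" "x \<bullet> b = B" by (simp_all add: A_def B_def inner_commute)
    have "plane_rotation a b t x \<bullet> plane_rotation a b t x
        = x \<bullet> x + 2 * (p * A + q * B) + p * p + q * q"
      unfolding plane_rotation_def A_def[symmetric] B_def[symmetric] p_def[symmetric] q_def[symmetric]
      by (simp add: inner_simps assms ba comm A_def[symmetric] B_def[symmetric] algebra_simps)
    also have "\<dots> = x \<bullet> x + (sin t * sin t + cos t * cos t - 1) * (A * A + B * B)"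
      unfolding p_def q_def by algebra
    finally have "plane_rotation a b t x \<bullet> plane_rotation a b t x = x \<bullet> x"
      unfolding sq by simp
    then show ?thesis by (simp add: norm_eq_sqrt_inner)
  qed
  with lin show ?thesis by (simp add: orthogonal_transformation)
qed

section \<open>Events on the sphere and their rotation invariance\<close>

lemma borel_measurable_sphere_uniform_inner [measurable]:
  "(\<lambda>r. u \<bullet> r) \<in> borel_measurable sphere_uniform"
proof -
  have "(\<lambda>r. u \<bullet> r) \<in> borel_measurable (restrict_space borel (sphere 0 1))"
    by (intro measurable_restrict_space1) measurable
  then show ?thesis
    by (simp add: measurable_cong_sets[OF sets_sphere_uniform refl])
qed

text \<open>A hyperplane is Lebesgue null, and radial projection does not change whether a nonzero
  point lies on it. Ties in the rounding are therefore negligible.\<close>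

lemma AE_sphere_uniform_inner_nonzero:
  fixes a :: "real^'n"
  assumes "a \<noteq> 0"
  shows "AE r in sphere_uniform. a \<bullet> r \<noteq> 0"
proof -
  let ?M = "uniform_measure lborel (ball 0 1) :: (real^'n) measure"
  have "negligible {x. a \<bullet> x = 0}" by (rule negligible_hyperplane) (use assms in simp)
  then have "AE x in lebesgue. a \<bullet> x \<noteq> 0"
    by (auto simp: negligible_iff_null_sets dest: AE_not_in)
  then have "AE x in lborel. a \<bullet> x \<noteq> 0"
    by (subst (asm) AE_completion_iff) auto
  then have "AE x in lborel. x \<in> ball (0::real^'n) 1 \<longrightarrow> a \<bullet> sgn x \<noteq> 0"
    by eventually_elim (auto simp: sgn_div_norm)
  then have "AE x in ?M. a \<bullet> sgn x \<noteq> 0"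
    by (intro AE_uniform_measureI) auto
  then have "AE x in distr ?M borel sgn. a \<bullet> x \<noteq> 0"
    by (subst AE_distr_iff) auto
  then show ?thesis
    unfolding sphere_uniform_def
    by (subst AE_restrict_space_iff) (auto intro: eventually_mono)
qed

text \<open>The event for \<open>u\<close>, \<open>v\<close> is pulled back along the
  measure-preserving \<open>f\<close>. The images \<open>u'\<close>, \<open>v'\<close> under the
  adjoint of \<open>f\<close> are specified through inner products only.\<close>

lemma separation_orthogonal:
  fixes f :: "real^'n::{finite,wellorder} \<Rightarrow> real^'n::_"
  assumes f: "orthogonal_transformation f"
    and "\<And>x. u \<bullet> f x = u' \<bullet> x" "\<And>x. v \<bullet> f x = v' \<bullet> x"
  shows "separation u v = separation u' v'"
proof -
  have meas: "f \<in> borel_measurable borel"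
    using f by (intro borel_measurable_continuous_onI linear_continuous_on)
      (simp add: orthogonal_transformation_linear linear_linear)
  have nf: "norm (f x) = norm x" for x
    using f by (simp add: orthogonal_transformation)
  have fS: "f \<in> measurable sphere_uniform sphere_uniform"
    unfolding measurable_cong_sets[OF sets_sphere_uniform sets_sphere_uniform]
    by (intro measurable_restrict_space2 measurable_restrict_space1)
      (auto simp: space_restrict_space nf meas)
  have "separation u v = measure (distr sphere_uniform sphere_uniform f)
      {r \<in> space sphere_uniform. (0 \<le> u \<bullet> r) \<noteq> (0 \<le> v \<bullet> r)}"
    unfolding separation_def by (simp add: distr_sphere_uniform_orthogonal[OF f])
  also have "\<dots> = measure sphere_uniform
      (f -` {r \<in> space sphere_uniform. (0 \<le> u \<bullet> r) \<noteq> (0 \<le> v \<bullet> r)} \<inter> space sphere_uniform)"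
    by (rule measure_distr[OF fS]) measurable
  also have "f -` {r \<in> space sphere_uniform. (0 \<le> u \<bullet> r) \<noteq> (0 \<le> v \<bullet> r)} \<inter> space sphere_uniform
      = {r \<in> space sphere_uniform. (0 \<le> u' \<bullet> r) \<noteq> (0 \<le> v' \<bullet> r)}"
    by (auto simp: space_sphere_uniform nf assms)
  finally show ?thesis unfolding separation_def .
qed

lemma separation_circle_shift:
  fixes a b :: "real^'n::{finite,wellorder}"
  assumes "a \<bullet> a = 1" "b \<bullet> b = 1" "a \<bullet> b = 0"
  shows "separation (circle_point a b (s + t)) (circle_point a b (s' + t))
       = separation (circle_point a b s) (circle_point a b s')"
  by (rule separation_orthogonal[OF orthogonal_transformation_plane_rotation[OF assms, of t]])
    (simp_all add: circle_point_inner_plane_rotation[OF assms])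

text \<open>Resolves the middle vector along the outer two, by the subtraction formula for
  \<open>t = (s + t) - s\<close>. All three sines are positive on a nondegenerate arc shorter than a
  half circle.\<close>

lemma circle_point_between:
  "sin (s + t) *\<^sub>R circle_point a b s = sin t *\<^sub>R circle_point a b 0 + sin s *\<^sub>R circle_point a b (s + t)"
proof -
  have "sin (s + t) * cos s = sin t + sin s * cos (s + t)"
  proof -
    have "sin t = sin ((s + t) - s)" by simp
    also have "\<dots> = sin (s + t) * cos s - cos (s + t) * sin s" by (rule sin_diff)
    finally show ?thesis by simp
  qed
  then have "(sin (s + t) * cos s) *\<^sub>R a = (sin t + sin s * cos (s + t)) *\<^sub>R a" by simp
  then show ?thesis by (simp add: circle_point_def algebra_simps)
qed

text \<open>
  Along an arc shorter than a half circle the middle vector is a positive combination of the outer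
  two, so the sign changes at most once.
\<close>

lemma separation_additive:
  fixes a b :: "real^'n::{finite,wellorder}"
  assumes ab: "a \<bullet> a = 1" "b \<bullet> b = 1" "a \<bullet> b = 0"
    and st: "0 \<le> s" "0 \<le> t" "s + t < pi"
  shows "separation a (circle_point a b (s + t))
       = separation a (circle_point a b s) + separation a (circle_point a b t)"
proof (cases "s = 0 \<or> t = 0")
  \<comment> \<open>The main case needs both sines strictly positive; here one arc is trivial and
    \<open>separation a a = 0\<close>.\<close>
  case True
  then show ?thesis by (auto simp: separation_def circle_point_def)
next
  case False
  then have pos: "0 < sin s" "0 < sin t" "0 < sin (s + t)"
    using st by (auto intro!: sin_gt_zero)
  interpret prob_space "sphere_uniform :: (real^'n::_) measure" by (rule prob_space_sphere_uniform)
  let ?u = "circle_point a b s" and ?v = "circle_point a b (s + t)"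
  let ?D = "\<lambda>u v. {r \<in> space sphere_uniform. (0 \<le> u \<bullet> r) \<noteq> (0 \<le> (v :: real^'n::_) \<bullet> r)}"
  have a: "circle_point a b 0 = a" by (simp add: circle_point_def)
  have key: "sin (s + t) * (?u \<bullet> r) = sin t * (a \<bullet> r) + sin s * (?v \<bullet> r)" for r
    using arg_cong[OF circle_point_between[of s t a b], of "\<lambda>x. x \<bullet> r"]
    by (simp add: inner_simps a)
  have mid: "0 \<le> ?u \<bullet> r" if "0 \<le> a \<bullet> r" "0 \<le> ?v \<bullet> r" for r
  proof -
    have "0 \<le> sin (s + t) * (?u \<bullet> r)" unfolding key using that pos by simp
    then show ?thesis using pos by (simp add: zero_le_mult_iff)
  qed
  have mid': "?u \<bullet> r < 0" if "a \<bullet> r < 0" "?v \<bullet> r < 0" for r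
  proof -
    have "sin (s + t) * (?u \<bullet> r) < 0" unfolding key
      using that pos by (intro add_neg_neg mult_pos_neg)
    then show ?thesis using pos by (simp add: mult_less_0_iff)
  qed
  have un: "?D a ?v = ?D a ?u \<union> ?D ?u ?v" and dis: "?D a ?u \<inter> ?D ?u ?v = {}"
    using mid mid' by (auto simp: not_le) (meson not_le)+
  have "separation a ?v = separation a ?u + separation ?u ?v"
    unfolding separation_def un by (rule finite_measure_Union[OF _ _ dis]) measurable
  also have "separation ?u ?v = separation a (circle_point a b t)"
    using separation_circle_shift[OF ab, of 0 s t] by (simp add: a add.commute)
  finally show ?thesis .
qed

text \<open>Off the null set \<open>u \<bullet> r = 0\<close> the vectors \<open>u\<close> and
  \<open>- u\<close> have opposite signs, so \<open>v\<close> disagrees with exactly one of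
  them.\<close>

lemma separation_antipodal:
  fixes u v :: "real^'n"
  assumes "u \<noteq> 0"
  shows "separation u v + separation v (- u) = 1"
proof -
  interpret prob_space "sphere_uniform :: (real^'n) measure" by (rule prob_space_sphere_uniform)
  let ?D = "\<lambda>u v. {r \<in> space sphere_uniform. (0 \<le> u \<bullet> r) \<noteq> (0 \<le> (v :: real^'n) \<bullet> r)}"
  have "AE r in sphere_uniform. r \<in> space sphere_uniform - ?D u v \<longleftrightarrow> r \<in> ?D v (-u)"
    using AE_sphere_uniform_inner_nonzero[OF assms] AE_space by eventually_elim auto
  then have "prob (space sphere_uniform - ?D u v) = prob (?D v (-u))"
    by (rule measure_eq_AE) measurable
  moreover have "prob (space sphere_uniform - ?D u v) = 1 - prob (?D u v)"
    by (rule prob_compl) measurable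
  ultimately show ?thesis by (simp add: separation_def)
qed

section \<open>Linearity in the angle\<close>

text \<open>Additivity makes \<open>k\<close> steps of size \<open>pi / (2 * N)\<close> contribute
  equally, and \<open>N\<close> of them form a right angle, which fixes the value of one step. The
  bound on \<open>k\<close> keeps all angles below \<open>pi\<close>.\<close>

lemma separation_circle_rational:
  fixes a b :: "real^'n::{finite,wellorder}"
  assumes ab: "a \<bullet> a = 1" "b \<bullet> b = 1" "a \<bullet> b = 0"
    and "k < 2 * N"
  shows "separation a (circle_point a b (real k * (pi / (2 * real N)))) = real k / (2 * real N)"
proof -
  let ?h = "pi / (2 * real N)"
  let ?S = "\<lambda>t. separation a (circle_point a b t)"
  have N: "N > 0" using assms by auto
  have mult: "?S (real k * ?h) = real k * ?S ?h" if "k < 2 * N" for k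
    using that
  proof (induction k)
    case 0
    then show ?case by (simp add: separation_def circle_point_def)
  next
    case (Suc k)
    have "real (Suc k) * ?h < (2 * real N) * ?h"
      using Suc.prems N by (intro mult_strict_right_mono) (auto simp flip: of_nat_mult)
    then have lt: "real k * ?h + ?h < pi" using N by (simp add: field_simps)
    have "?S (real k * ?h + ?h) = ?S (real k * ?h) + ?S ?h"
      by (rule separation_additive[OF ab]) (use N lt in auto)
    moreover have "real (Suc k) * ?h = real k * ?h + ?h"
      by (simp only: of_nat_Suc distrib_right mult_1 add.commute)
    ultimately show ?case using Suc by (simp add: distrib_right)
  qed
  have a: "circle_point a b 0 = a" "circle_point a b pi = - a" by (simp_all add: circle_point_def)
  \<comment> \<open>The half circle from \<open>a\<close> to \<open>- a\<close> splits at
    \<open>b\<close> into two quarter arcs that are congruent by rotation, so each has value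
    1/2.\<close>
  have "?S (pi / 2) + separation (circle_point a b (pi / 2)) (- a) = 1"
    by (rule separation_antipodal) (use ab in auto)
  moreover have "separation (circle_point a b (pi / 2)) (- a) = ?S (pi / 2)"
    using separation_circle_shift[OF ab, of 0 "pi/2" "pi/2"] by (simp add: a)
  ultimately have "?S (pi / 2) = 1 / 2" by simp
  moreover have "real N * ?h = pi / 2" using N by simp
  ultimately have "real N * ?S ?h = 1 / 2" using mult[of N] N by simp
  then have "?S ?h = 1 / (2 * real N)" using N by (simp add: field_simps)
  then show ?thesis using mult[OF assms(4)] by simp
qed

lemma separation_circle_mono:
  fixes a b :: "real^'n::{finite,wellorder}"
  assumes ab: "a \<bullet> a = 1" "b \<bullet> b = 1" "a \<bullet> b = 0"
    and st: "0 \<le> s" "s \<le> t" "t < pi"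
  shows "separation a (circle_point a b s) \<le> separation a (circle_point a b t)"
  using separation_additive[OF ab, of s "t - s"] st by (simp add: separation_def)

lemma separation_circle:
  fixes a b :: "real^'n::{finite,wellorder}"
  assumes ab: "a \<bullet> a = 1" "b \<bullet> b = 1" "a \<bullet> b = 0"
    and t: "0 \<le> t" "t < pi"
  shows "separation a (circle_point a b t) = t / pi"
proof -
  let ?S = "\<lambda>t. separation a (circle_point a b t)"
  interpret prob_space "sphere_uniform :: (real^'n::_) measure" by (rule prob_space_sphere_uniform)
  have rat: "?S (q * pi) = q" if q: "q \<in> \<rat>" "0 \<le> q" "q < 1" for q
  proof -
    obtain m n :: nat where mn: "n \<noteq> 0" "\<bar>q\<bar> = real m / real n"
      using Rats_abs_nat_div_natE[OF q(1)] by metis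
    have "real m < real n" using q mn by simp
    \<comment> \<open>Doubling numerator and denominator puts \<open>q * pi\<close> on the grid of
      step \<open>pi / (2 * n)\<close>.\<close>
    then have "q = real (2 * m) / (2 * real n)" "2 * m < 2 * n"
      using q mn by (simp_all add: field_simps)
    with separation_circle_rational[OF ab, of "2 * m" n] show ?thesis by simp
  qed
  \<comment> \<open>A rational \<open>q\<close> strictly between the two values is attained at the
    angle \<open>q * pi < t\<close>, against monotonicity; the other direction is the mirror
    image.\<close>
  have "\<not> ?S t < t / pi"
  proof
    assume "?S t < t / pi"
    then obtain q where q: "q \<in> \<rat>" "?S t < q" "q < t / pi" using Rats_dense_in_real by blast
    have "0 \<le> ?S t" by (simp add: separation_def)
    then have q0: "0 \<le> q" using q by linarith
    have "q * pi < t" using q by (simp add: field_simps)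
    moreover have "t / pi < 1" using t by simp
    then have "q < 1" using q by linarith
    ultimately show False
      using rat[OF q(1) q0] separation_circle_mono[OF ab, of "q * pi" t] q0 q t by auto
  qed
  moreover have "\<not> t / pi < ?S t"
  proof
    assume "t / pi < ?S t"
    then obtain q where q: "q \<in> \<rat>" "t / pi < q" "q < ?S t" using Rats_dense_in_real by blast
    have "?S t \<le> 1" by (simp add: separation_def)
    then have q1: "q < 1" using q by linarith
    have "t < q * pi" using q by (simp add: field_simps)
    moreover have "0 \<le> t / pi" using t by simp
    then have q0: "0 \<le> q" using q by linarith
    ultimately show False
      using rat[OF q(1) q0 q1] separation_circle_mono[OF ab, of t "q * pi"] q1 q t by auto
  qed
  ultimately show ?thesis by linarith
qed

text \<open>Gram-Schmidt: normalising the part \<open>w\<close> of \<open>v\<close> orthogonal to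
  \<open>u\<close> gives \<open>b\<close>, and \<open>v\<close> lies on the circle through
  \<open>u\<close> and \<open>b\<close> at angle \<open>arccos c\<close>.\<close>

lemma separation_eq_arccos:
  fixes u v :: "real^'n::{finite,wellorder}"
  assumes u: "norm u = 1" and v: "norm v = 1"
  shows "separation u v = arccos (u \<bullet> v) / pi"
proof -
  have uu: "u \<bullet> u = 1" and vv: "v \<bullet> v = 1" using u v by (simp_all add: dot_square_norm)
  define c where "c = u \<bullet> v"
  have c: "-1 \<le> c" "c \<le> 1" using Cauchy_Schwarz_ineq2[of u v] u v by (auto simp: c_def)
  define w where "w = v - c *\<^sub>R u"
  have ww: "w \<bullet> w = 1 - c * c"
    by (simp add: w_def inner_simps uu vv inner_commute[of v u] c_def[symmetric])
  \<comment> \<open>At \<open>c = 1\<close> and \<open>c = - 1\<close> the vector \<open>w\<close>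
    vanishes and cannot be normalised; then \<open>v\<close> is \<open>u\<close> or
    \<open>- u\<close>.\<close>
  consider "c = 1" | "c = - 1" | "-1 < c" "c < 1" using c by linarith
  then show ?thesis
  proof cases
    case 1
    then have "v = u" using ww by (simp add: w_def)
    then show ?thesis using uu by (simp add: separation_def)
  next
    case 2
    then have "v = - u" using ww by (simp add: w_def add_eq_0_iff2)
    moreover have "separation u u + separation u (- u) = 1"
      by (rule separation_antipodal) (use u in auto)
    ultimately show ?thesis using uu by (simp add: separation_def)
  next
    case 3
    define b where "b = w /\<^sub>R sqrt (1 - c * c)"
    have pos: "0 < 1 - c * c" using 3 by (simp add: abs_square_less_1 flip: power2_eq_square)
    have bb: "b \<bullet> b = 1" using pos by (simp add: b_def ww divide_simps)
    have ub: "u \<bullet> b = 0" by (simp add: b_def w_def inner_simps uu c_def)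
    have "sqrt (1 - c * c) *\<^sub>R b = w" using pos by (simp add: b_def)
    then have "circle_point u b (arccos c) = v"
      using c by (simp add: circle_point_def sin_arccos w_def power2_eq_square)
    moreover have "arccos c < pi" "0 \<le> arccos c"
      using arccos_lt_bounded[OF 3] by auto
    ultimately show ?thesis
      using separation_circle[OF uu bb ub, of "arccos c"] by (simp add: c_def)
  qed
qed

subsection \<open>The Goemans--Williamson constant\<close>

text \<open>Fourth-order Maclaurin expansion: the Lagrange remainder is a cosine, at most 1, times
  \<open>x ^ 4 / 24\<close>.\<close>

lemma cos_le_quartic:
  fixes x :: real
  shows "cos x \<le> 1 - x\<^sup>2 / 2 + x ^ 4 / 24"
proof -
  obtain t where "cos x = (\<Sum>m<4. cos_coeff m * x ^ m) + cos (t + 1/2 * real 4 * pi) / fact 4 * x ^ 4"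
    using Maclaurin_cos_expansion[of x 4] by blast
  also have "\<dots> = 1 - x\<^sup>2 / 2 + cos (t + 2 * pi) / 24 * x ^ 4"
    by (simp add: lessThan_nat_numeral cos_coeff_def fact_numeral)
  also have "cos (t + 2 * pi) / 24 * x ^ 4 \<le> 1 / 24 * x ^ 4"
    by (intro mult_right_mono divide_right_mono) auto
  finally show ?thesis by simp
qed

lemma one_minus_cos_le:
  fixes x :: real
  shows "1 - cos x \<le> x\<^sup>2 / 2"
proof -
  have "(sin (x/2))\<^sup>2 \<le> (x/2)\<^sup>2"
    using abs_sin_x_le_abs_x[of "x/2"] by (simp only: abs_le_square_iff)
  then show ?thesis using cos_double_sin[of "x/2"] by (simp add: power_divide)
qed

text \<open>
  The left-hand side is \<open>0.439 * (1 - cos (pi - y))\<close> with \<open>cos y\<close> replaced by its quartic Taylor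
  bound. Both sides nearly touch at \<open>y = 0.816\<close>, so the proof splits off a square there.
\<close>

lemma gw_quartic_bound:
  fixes y :: real
  assumes "0 \<le> y" "y \<le> 2"
  shows "0.439 * (2 - y\<^sup>2 / 2 + y ^ 4 / 24) \<le> 1 - y / 3.14"
proof -
  \<comment> \<open>The coefficient 0.068 = 2 * 0.816 / 24 cancels the cubic term, and 0.416768
    makes the quadratic coefficient exactly 1/2.\<close>
  have "0 \<le> (y - 0.816)\<^sup>2 * (0.416768 - 0.068 * y - y\<^sup>2 / 24)"
  proof (rule mult_nonneg_nonneg)
    have "y\<^sup>2 \<le> 2 * 2" unfolding power2_eq_square using assms by (intro mult_mono) auto
    then show "0 \<le> 0.416768 - 0.068 * y - y\<^sup>2 / 24" using assms by simp
  qed simp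
  also have "\<dots> = 0.416768 * 0.816\<^sup>2 - (2 * 0.816 * 0.416768 + 0.068 * 0.816\<^sup>2) * y + y\<^sup>2 / 2 - y ^ 4 / 24"
    by (simp add: power2_eq_square power4_eq_xxxx field_simps)
  \<comment> \<open>The constant is rounded up and the slope down, which is safe for
    \<open>y \<ge> 0\<close>. Multiplied by 0.439, the slope misses 1/3.14 by less than
    0.000003.\<close>
  finally have "y ^ 4 / 24 - y\<^sup>2 / 2 \<le> 0.27751 - 0.725442 * y"
    using assms by (simp add: power2_eq_square)
  then show ?thesis using assms by simp
qed

text \<open>For \<open>t \<le> 1.42\<close> the quadratic bound suffices, because 0.439 * 0.71 <
  1/3.2 < 1/pi. The critical angle lies in the other range, where \<open>y = pi - t\<close> is below
  2 and the quartic bound applies.\<close>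

lemma gw_ratio_angle:
  fixes t :: real
  assumes "0 \<le> t" "t \<le> pi"
  shows "0.878 * ((1 - cos t) / 2) \<le> t / pi"
proof (cases "t \<le> 1.42")
  case True
  have "1 - cos t \<le> t\<^sup>2 / 2" by (rule one_minus_cos_le)
  also have "\<dots> \<le> 1.42 * t / 2"
    unfolding power2_eq_square using assms True by (intro divide_right_mono mult_right_mono) auto
  finally have "0.878 * ((1 - cos t) / 2) \<le> t * (1 / 3.2)" using assms by simp
  also have "\<dots> \<le> t * (1 / pi)"
    using assms pi_approx by (intro mult_left_mono divide_left_mono) auto
  finally show ?thesis by simp
next
  case False
  define y where "y = pi - t"
  have y: "0 \<le> y" "y \<le> 2" using assms False pi_approx by (auto simp: y_def)
  have "y * (1 / pi) \<le> y * (1 / 3.14)"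
    using y pi_approx by (intro mult_left_mono divide_left_mono) auto
  then have "1 - y / 3.14 \<le> t / pi" by (simp add: y_def diff_divide_distrib)
  moreover have "cos t = - cos y" by (simp add: y_def)
  moreover have "cos y \<le> 1 - y\<^sup>2 / 2 + y ^ 4 / 24" by (rule cos_le_quartic)
  ultimately show ?thesis using gw_quartic_bound[OF y] by simp
qed

lemma gw_ratio_arccos:
  fixes x :: real
  assumes "-1 \<le> x" "x \<le> 1"
  shows "0.878 * ((1 - x) / 2) \<le> arccos x / pi"
  using gw_ratio_angle[of "arccos x"] arccos_bounded[OF assms] cos_arccos[OF assms] by simp

subsection \<open>Cuts and the semidefinite relaxation\<close>

lemma symmetric_matrix_entry:
  assumes "transpose A = A"
  shows "A $ j $ i = A $ i $ j"
proof -
  have "transpose A $ i $ j = A $ i $ j" using assms by simp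
  then show ?thesis by (simp add: transpose_def)
qed

lemma AE_random_matrix_law:
  assumes "random_matrix_law \<Xi> P" "\<And>W i j. W \<in> \<Xi> \<Longrightarrow> 0 \<le> W $ i $ j"
  shows "AE W in P. (\<forall>i j. 0 \<le> W $ i $ j) \<and> (\<forall>i j. W $ j $ i = W $ i $ j)"
proof -
  have "AE W in P. W \<in> \<Xi> \<and> transpose W = W"
    using assms(1) by (simp add: random_matrix_law_def)
  then show ?thesis
    by eventually_elim (blast intro: assms(2) symmetric_matrix_entry)
qed

lemma cut_value_eq_cut_sum: "cut_value y W = cut_sum y W / 2"
  by (simp add: cut_value_def cut_sum_def sum_divide_distrib)

lemma cut_vectors_bounds:
  assumes "y \<in> cut_vectors"
  shows "0 \<le> 1 - y $ i * y $ j" "y $ i * y $ i = 1"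
proof -
  have "y $ i = - 1 \<or> y $ i = 1" "y $ j = - 1 \<or> y $ j = 1"
    using assms by (auto simp: cut_vectors_def)
  then show "0 \<le> 1 - y $ i * y $ j" "y $ i * y $ i = 1" by auto
qed

lemma cut_sum_nonneg:
  assumes "y \<in> cut_vectors" "\<And>i j. 0 \<le> W $ i $ j"
  shows "0 \<le> cut_sum y W"
  unfolding cut_sum_def
  by (intro sum_nonneg mult_nonneg_nonneg assms cut_vectors_bounds)

lemma entry_le_cut_sum:
  fixes W :: "real^'n::{finite,wellorder}^'n::_"
  assumes "i < j" "y \<in> cut_vectors" "y $ i = 1" "y $ j = - 1" "\<And>i j. 0 \<le> W $ i $ j"
  shows "2 * (W $ i $ j) \<le> cut_sum y W"
proof -
  have nn: "0 \<le> W $ k $ l * (1 - y $ k * y $ l)" for k l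
    by (intro mult_nonneg_nonneg assms cut_vectors_bounds)
  have "2 * (W $ i $ j) = W $ i $ j * (1 - y $ i * y $ j)" using assms by simp
  also have "\<dots> \<le> (\<Sum>l | i < l. W $ i $ l * (1 - y $ i * y $ l))"
    by (rule member_le_sum[of j "{l. i < l}" "\<lambda>l. W $ i $ l * (1 - y $ i * y $ l)"])
      (use assms(1) nn in simp_all)
  also have "\<dots> \<le> cut_sum y W"
    unfolding cut_sum_def
    by (rule member_le_sum[of i UNIV "\<lambda>i. \<Sum>l | i < l. W $ i $ l * (1 - y $ i * y $ l)"])
      (use nn in \<open>auto intro!: sum_nonneg\<close>)
  finally show ?thesis .
qed

text \<open>The expected rounded cut weights the entries by arccosines, so it is not one cut sum and
  its integrability is reduced to single entries. Each entry is dominated by the cut sum of the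
  vector that isolates \<open>j\<close>.\<close>

lemma integrable_upper_entry:
  fixes P :: "(real^'n::{finite,wellorder}^'n::_) measure"
  assumes law: "random_matrix_law \<Xi> P" and nonneg: "\<And>W i j. W \<in> \<Xi> \<Longrightarrow> 0 \<le> W $ i $ j"
    and int: "\<And>y. y \<in> cut_vectors \<Longrightarrow> integrable P (cut_sum y)"
    and "i < j"
  shows "integrable P (\<lambda>W. W $ i $ j)"
proof -
  define y :: "real^'n::_" where "y = (\<chi> k. if k = j then - 1 else 1)"
  have y: "y \<in> cut_vectors" "y $ i = 1" "y $ j = - 1"
    using assms(4) by (auto simp: y_def cut_vectors_def)
  have AE_law: "AE W in P. (\<forall>i j. 0 \<le> W $ i $ j) \<and> (\<forall>i j. W $ j $ i = W $ i $ j)"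
    by (rule AE_random_matrix_law[OF law]) (rule nonneg)
  have sets: "sets P = sets borel" using law by (simp add: random_matrix_law_def)
  have "(\<lambda>W :: real^'n::_^'n::_. W $ i $ j) \<in> borel_measurable borel"
    by (intro borel_measurable_continuous_onI continuous_intros)
  then have meas: "(\<lambda>W. W $ i $ j) \<in> borel_measurable P"
    by (simp add: measurable_cong_sets[OF sets refl])
  show ?thesis
  proof (rule Bochner_Integration.integrable_bound[OF int[OF y(1)] meas])
    show "AE W in P. norm (W $ i $ j) \<le> norm (cut_sum y W)"
      using AE_law
    proof eventually_elim
      case (elim W)
      then have "2 * (W $ i $ j) \<le> cut_sum y W" "0 \<le> W $ i $ j"
        using entry_le_cut_sum[OF \<open>i < j\<close> y] by auto
      then show ?case by simp
    qed
  qed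
qed

section \<open>The semidefinite objective as a sum over pairs\<close>

lemma sum_offdiagonal_symmetric:
  fixes f :: "'n::{finite,wellorder} \<Rightarrow> 'n \<Rightarrow> real"
  assumes "\<And>i j. f i j = f j i" "\<And>i. f i i = 0"
  shows "(\<Sum>i\<in>UNIV. \<Sum>j\<in>UNIV. f i j) = 2 * (\<Sum>i\<in>UNIV. \<Sum>j | i < j. f i j)"
proof -
  have split: "(\<Sum>j\<in>UNIV. f i j) = (\<Sum>j | i < j. f i j) + (\<Sum>j | j < i. f i j)" for i
  proof -
    have "UNIV = insert i ({j. i < j} \<union> {j. j < i})" by auto
    then have "(\<Sum>j\<in>UNIV. f i j) = (\<Sum>j\<in>insert i ({j. i < j} \<union> {j. j < i}). f i j)" by simp
    also have "\<dots> = (\<Sum>j\<in>{j. i < j} \<union> {j. j < i}. f i j)" by (simp add: assms(2))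
    also have "\<dots> = (\<Sum>j | i < j. f i j) + (\<Sum>j | j < i. f i j)"
      by (rule sum.union_disjoint) auto
    finally show ?thesis .
  qed
  have "(\<Sum>i\<in>UNIV. \<Sum>j | j < i. f i j) = (\<Sum>i\<in>UNIV. \<Sum>j\<in>UNIV. if j < i then f i j else 0)"
    by (simp add: sum.inter_filter[symmetric])
  also have "\<dots> = (\<Sum>j\<in>UNIV. \<Sum>i\<in>UNIV. if j < i then f i j else 0)"
    by (rule sum.swap)
  also have "\<dots> = (\<Sum>j\<in>UNIV. \<Sum>i | j < i. f i j)"
    by (simp add: sum.inter_filter[symmetric])
  also have "\<dots> = (\<Sum>i\<in>UNIV. \<Sum>j | i < j. f i j)"
    by (intro sum.cong refl assms(1))
  finally show ?thesis by (simp add: split sum.distrib)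
qed

text \<open>The unit diagonal of \<open>Y\<close> removes the diagonal of \<open>W\<close>; symmetry
  pairs the remaining entries, and the resulting 2 reconciles the factors 1/4 and 1/2 of the two
  problems.\<close>

lemma sdp_integrand_upper:
  fixes W Y :: "real^'n::{finite,wellorder}^'n::_"
  assumes "\<And>i j. W $ j $ i = W $ i $ j" and Y: "Y \<in> elliptope"
  shows "sdp_integrand Y W = 2 * (\<Sum>i\<in>UNIV. \<Sum>j | i < j. W $ i $ j * (1 - Y $ i $ j))"
proof -
  let ?f = "\<lambda>i j. W $ i $ j * (1 - Y $ i $ j)"
  have "transpose Y = Y" using Y by (simp add: elliptope_def psd_def)
  then have "?f i j = ?f j i" for i j
    using symmetric_matrix_entry[of Y] by (simp only: assms(1)[of i j])
  moreover have "?f i i = 0" for i using Y by (simp add: elliptope_def)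
  ultimately have "(\<Sum>i\<in>UNIV. \<Sum>j\<in>UNIV. ?f i j) = 2 * (\<Sum>i\<in>UNIV. \<Sum>j | i < j. ?f i j)"
    by (rule sum_offdiagonal_symmetric)
  then show ?thesis by (simp add: sdp_integrand_def inner_vec_def)
qed

lemma rank_one_elliptope:
  fixes y :: "real^'n"
  assumes y: "y \<in> cut_vectors"
  shows "(\<chi> i j. y $ i * y $ j) \<in> elliptope"
proof -
  let ?Y = "(\<chi> i j. y $ i * y $ j) :: real^'n^'n"
  have "?Y *v x = (y \<bullet> x) *\<^sub>R y" for x
    by (simp add: vec_eq_iff matrix_vector_mult_def inner_vec_def sum_distrib_left sum_distrib_right
        algebra_simps)
  then have "0 \<le> x \<bullet> (?Y *v x)" for x by (simp add: inner_commute[of x y])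
  then show ?thesis
    using y by (auto simp: elliptope_def psd_def transpose_def vec_eq_iff mult.commute cut_vectors_bounds)
qed

lemma sdp_integrand_rank_one:
  fixes W :: "real^'n::{finite,wellorder}^'n::_"
  assumes "\<And>i j. W $ j $ i = W $ i $ j" "y \<in> cut_vectors"
  shows "sdp_integrand (\<chi> i j. y $ i * y $ j) W = 2 * cut_sum y W"
  by (simp add: sdp_integrand_upper[OF assms(1) rank_one_elliptope[OF assms(2)]] cut_sum_def)

lemma gw_round_in_cut_vectors: "gw_round U r \<in> cut_vectors"
  by (simp add: gw_round_def cut_vectors_def)

text \<open>Needed to reason about the \<open>MAX\<close> in \<open>drp_value\<close>, which is
  meaningful only over a finite nonempty set.\<close>

lemma finite_cut_vectors: "finite (cut_vectors :: (real^'n) set)"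
proof -
  have "(cut_vectors :: (real^'n) set) \<subseteq> vec_lambda ` (UNIV \<rightarrow>\<^sub>E {- 1, 1 :: real}) "
  proof
    fix y :: "real^'n" assume "y \<in> cut_vectors"
    then show "y \<in> vec_lambda ` (UNIV \<rightarrow>\<^sub>E {- 1, 1})"
      by (intro image_eqI[of _ _ "vec_nth y"]) (auto simp: cut_vectors_def)
  qed
  then show ?thesis by (rule finite_subset) (simp add: finite_PiE)
qed

text \<open>For rounded signs, (1 - y_i y_j) / 2 is the indicator of the separation event; linearity
  of expectation does the rest.\<close>

lemma expected_cut_value_gw_round:
  fixes U W :: "real^'n::{finite,wellorder}^'n::_"
  assumes U: "\<And>i. norm (column i U) = 1"
  shows "(\<integral>r. cut_value (gw_round U r) W \<partial>sphere_uniform)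
       = (\<Sum>i\<in>UNIV. \<Sum>j | i < j. W $ i $ j * (arccos (column i U \<bullet> column j U) / pi))"
proof -
  interpret prob_space "sphere_uniform :: (real^'n::_) measure" by (rule prob_space_sphere_uniform)
  let ?D = "\<lambda>i j. {r \<in> space sphere_uniform. (0 \<le> column i U \<bullet> r) \<noteq> (0 \<le> column j U \<bullet> r)}"
  have D: "?D i j \<in> sets sphere_uniform" for i j by measurable
  have int: "integrable sphere_uniform (indicator (?D i j) :: _ \<Rightarrow> real)" for i j
    using D[of i j] by (intro integrable_real_indicator) (auto simp: emeasure_finite less_top[symmetric])
  have "(\<integral>r. cut_value (gw_round U r) W \<partial>sphere_uniform)
      = (\<integral>r. (\<Sum>i\<in>UNIV. \<Sum>j | i < j. W $ i $ j * indicator (?D i j) r) \<partial>sphere_uniform)"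
    unfolding cut_value_def
    by (intro Bochner_Integration.integral_cong refl sum.cong) (auto simp: gw_round_def)
  also have "\<dots> = (\<Sum>i\<in>UNIV. \<Sum>j | i < j. \<integral>r. W $ i $ j * indicator (?D i j) r \<partial>sphere_uniform)"
    by (subst Bochner_Integration.integral_sum,
        intro Bochner_Integration.integrable_sum integrable_mult_right int,
        intro sum.cong refl,
        subst Bochner_Integration.integral_sum,
        intro integrable_mult_right int) simp
  also have "\<dots> = (\<Sum>i\<in>UNIV. \<Sum>j | i < j. W $ i $ j * separation (column i U) (column j U))"
    using D by (intro sum.cong refl) (simp add: separation_def)
  finally show ?thesis by (simp add: separation_eq_arccos U)
qed

lemma column_inner_gram: "column i U \<bullet> column j U = (transpose U ** U) $ i $ j"
  for U :: "real^'n^'m"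
  by (simp add: column_def inner_vec_def transpose_def matrix_matrix_mult_def)

theorem theorem2:
  fixes \<Xi> :: "(real^'n::{finite,wellorder}^'n::_) set"
    and \<P> :: "(real^'n::_^'n::_) measure set"
    and Yhat U :: "real^'n::_^'n::_"
    and Phat :: "(real^'n::_^'n::_) measure"
    and Phat' :: "real^'n::_ \<Rightarrow> (real^'n::_^'n::_) measure"
  assumes Xi_nonneg: "\<And>W i j. W \<in> \<Xi> \<Longrightarrow> 0 \<le> W $ i $ j"
    and laws: "\<And>P. P \<in> \<P> \<Longrightarrow> random_matrix_law \<Xi> P"
    and integrable_cut: "\<And>P y. P \<in> \<P> \<Longrightarrow> y \<in> cut_vectors \<Longrightarrow> integrable P (cut_sum y)"
    and integrable_sdp: "\<And>P Y. P \<in> \<P> \<Longrightarrow> Y \<in> elliptope \<Longrightarrow> integrable P (sdp_integrand Y)"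
    and attained_cut: "\<And>y. y \<in> cut_vectors \<Longrightarrow>
          \<exists>P. is_arg_min (\<lambda>P. \<integral>W. cut_sum y W \<partial>P) (\<lambda>P. P \<in> \<P>) P"
    and attained_sdp: "\<And>Y. Y \<in> elliptope \<Longrightarrow>
          \<exists>P. is_arg_min (\<lambda>P. \<integral>W. sdp_integrand Y W \<partial>P) (\<lambda>P. P \<in> \<P>) P"
    and Yhat_optimal: "is_arg_max (sdp_value \<P>) (\<lambda>Y. Y \<in> elliptope) Yhat"
    and Phat_worst: "is_arg_min (\<lambda>P. \<integral>W. sdp_integrand Yhat W \<partial>P) (\<lambda>P. P \<in> \<P>) Phat"
    and factor: "Yhat = transpose U ** U"
    and Phat'_worst: "\<And>r. r \<in> sphere 0 1 \<Longrightarrow>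
          is_arg_min (\<lambda>P. \<integral>W. cut_value (gw_round U r) W \<partial>P) (\<lambda>P. P \<in> \<P>) (Phat' r)"
  shows "(\<forall>P\<in>\<P>. (\<integral>W. (\<integral>r. cut_value (gw_round U r) W \<partial>sphere_uniform) \<partial>P)
                     \<ge> 0.878 * drp_value \<P>)
       \<and> (\<integral>W. (\<integral>r. cut_value (gw_round U r) W \<partial>sphere_uniform) \<partial>Phat) \<ge> 0.878 * drp_value \<P>
       \<and> drp_value \<P> \<ge> (\<integral>r. (\<integral>W. cut_value (gw_round U r) W \<partial>(Phat' r)) \<partial>sphere_uniform)"
proof -
  interpret S: prob_space "sphere_uniform :: (real^'n::_) measure" by (rule prob_space_sphere_uniform)
  have Yhat: "Yhat \<in> elliptope" using Yhat_optimal by (simp add: is_arg_max_def)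
  have Phat: "Phat \<in> \<P>" using Phat_worst by (simp add: is_arg_min_def)
  then have ne: "\<P> \<noteq> {}" by auto
  have AE_law: "AE W in P. (\<forall>i j. 0 \<le> W $ i $ j) \<and> (\<forall>i j. W $ j $ i = W $ i $ j)" if "P \<in> \<P>" for P
    by (rule AE_random_matrix_law[OF laws[OF that]]) (rule Xi_nonneg)
  have gram: "column i U \<bullet> column j U = Yhat $ i $ j" for i j
    by (simp add: column_inner_gram factor)
  have norm_col: "norm (column i U) = 1" for i
    using Yhat by (simp add: norm_eq_sqrt_inner gram elliptope_def)
  have Y_bounds: "- 1 \<le> Yhat $ i $ j" "Yhat $ i $ j \<le> 1" for i j
    using Cauchy_Schwarz_ineq2[of "column i U" "column j U"] by (auto simp: gram norm_col)

  define worst where "worst y = (INF P\<in>\<P>. \<integral>W. cut_sum y W \<partial>P)" for y :: "real^'n::_"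
  have drp: "drp_value \<P> = 1/2 * Max (worst ` cut_vectors)"
    by (simp add: drp_value_def worst_def)
  have cut_nonneg: "0 \<le> (\<integral>W. cut_sum y W \<partial>P)" if "P \<in> \<P>" "y \<in> cut_vectors" for P y
    by (rule integral_nonneg_AE)
      (use AE_law[OF that(1)] cut_sum_nonneg[OF that(2)] in \<open>auto elim: eventually_mono\<close>)
  have fin: "finite (worst ` cut_vectors)" by (simp add: finite_cut_vectors)
  have worst_le_drp: "worst y / 2 \<le> drp_value \<P>" if "y \<in> cut_vectors" for y
    unfolding drp using Max_ge[OF fin, of "worst y"] that by simp

  have sdp_ge: "drp_value \<P> \<le> sdp_value \<P> Yhat"
  proof -
    have "Max (worst ` cut_vectors) \<in> worst ` cut_vectors"
      by (rule Max_in[OF fin]) (use gw_round_in_cut_vectors[of U] in blast)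
    then obtain y where y: "y \<in> cut_vectors" "drp_value \<P> = worst y / 2" unfolding drp by auto
    let ?Y = "\<chi> i j. y $ i * y $ j"
    have "worst y / 2 \<le> sdp_value \<P> ?Y"
      unfolding sdp_value_def
    proof (rule cINF_greatest[OF ne])
      fix P assume P: "P \<in> \<P>"
      \<comment> \<open>A real infimum is a lower bound only for families bounded below;
        nonnegativity of the cuts supplies the bound 0.\<close>
      have "worst y \<le> (\<integral>W. cut_sum y W \<partial>P)"
        unfolding worst_def
        by (rule cINF_lower[OF _ P], rule bdd_belowI2) (use cut_nonneg y in auto)
      \<comment> \<open>The integrands are matched on symmetric matrices, hence almost everywhere
        under \<open>P\<close>.\<close>
      moreover have "(\<integral>W. sdp_integrand ?Y W \<partial>P) = (\<integral>W. 2 * cut_sum y W \<partial>P)"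
      proof (rule integral_cong_AE)
        show "AE W in P. sdp_integrand ?Y W = 2 * cut_sum y W"
          using AE_law[OF P] by eventually_elim (rule sdp_integrand_rank_one, use y in auto)
      qed (use integrable_sdp[OF P rank_one_elliptope[OF y(1)]] integrable_cut[OF P y(1)] in auto)
      ultimately show "worst y / 2 \<le> 1 / 4 * (\<integral>W. sdp_integrand ?Y W \<partial>P)" by simp
    qed
    also have "\<dots> \<le> sdp_value \<P> Yhat"
      using Yhat_optimal rank_one_elliptope[OF y(1)] by (auto simp: is_arg_max_def not_less)
    finally show ?thesis using y by simp
  qed

  have lower: "0.878 * drp_value \<P> \<le> (\<integral>W. (\<integral>r. cut_value (gw_round U r) W \<partial>sphere_uniform) \<partial>P)"
    if P: "P \<in> \<P>" for P
  proof -
    have "sdp_value \<P> Yhat \<le> 1 / 4 * (\<integral>W. sdp_integrand Yhat W \<partial>P)"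
      unfolding sdp_value_def
    \<comment> \<open>The value at the minimiser \<open>Phat\<close> is the lower bound of the
      family.\<close>
    proof (rule cINF_lower[OF _ P], rule bdd_belowI2)
      fix Q assume "Q \<in> \<P>"
      then show "1 / 4 * (\<integral>W. sdp_integrand Yhat W \<partial>Phat) \<le> 1 / 4 * (\<integral>W. sdp_integrand Yhat W \<partial>Q)"
        using Phat_worst by (auto simp: is_arg_min_def not_less)
    qed
    \<comment> \<open>Moving the constant under the integral reduces the claim to a comparison for
      almost every \<open>W\<close>, edge by edge.\<close>
    with sdp_ge have "0.878 * drp_value \<P> \<le> (\<integral>W. 0.878 / 4 * sdp_integrand Yhat W \<partial>P)" by simp
    also have "\<dots> \<le> (\<integral>W. (\<integral>r. cut_value (gw_round U r) W \<partial>sphere_uniform) \<partial>P)"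
      unfolding expected_cut_value_gw_round[OF norm_col]
    proof (rule integral_mono_AE)
      show "integrable P (\<lambda>W. 0.878 / 4 * sdp_integrand Yhat W)"
        using integrable_sdp[OF P Yhat] by simp
      show "integrable P (\<lambda>W. \<Sum>i\<in>UNIV. \<Sum>j | i < j. W $ i $ j * (arccos (column i U \<bullet> column j U) / pi))"
        by (intro Bochner_Integration.integrable_sum integrable_mult_left
            integrable_upper_entry[OF laws[OF P]])
          (auto intro: Xi_nonneg integrable_cut[OF P])
      show "AE W in P. 0.878 / 4 * sdp_integrand Yhat W
          \<le> (\<Sum>i\<in>UNIV. \<Sum>j | i < j. W $ i $ j * (arccos (column i U \<bullet> column j U) / pi))"
        using AE_law[OF P]
      proof eventually_elim
        case (elim W)
        have "0.878 / 4 * sdp_integrand Yhat W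
            = (\<Sum>i\<in>UNIV. \<Sum>j | i < j. W $ i $ j * (0.878 * ((1 - Yhat $ i $ j) / 2)))"
          using elim by (subst sdp_integrand_upper[OF _ Yhat])
            (blast, unfold sum_distrib_left, intro sum.cong refl, simp)
        also have "\<dots> \<le> (\<Sum>i\<in>UNIV. \<Sum>j | i < j. W $ i $ j * (arccos (column i U \<bullet> column j U) / pi))"
          unfolding gram using elim
          by (intro sum_mono mult_left_mono gw_ratio_arccos Y_bounds) auto
        finally show ?case .
      qed
    qed
    finally show ?thesis .
  qed

  have upper: "(\<integral>W. cut_value (gw_round U r) W \<partial>(Phat' r)) \<le> drp_value \<P>" if "r \<in> sphere 0 1" for r
  proof -
    let ?y = "gw_round U r"
    note min = Phat'_worst[OF that]
    \<comment> \<open>Halving the objective does not change its minimisers, so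
      \<open>Phat' r\<close> is also worst for \<open>cut_sum\<close>.\<close>
    have "(\<integral>W. cut_sum ?y W \<partial>Phat' r) \<le> worst ?y"
      unfolding worst_def
      by (rule cINF_greatest[OF ne]) (use min in \<open>auto simp: is_arg_min_def not_less cut_value_eq_cut_sum\<close>)
    then show ?thesis
      using worst_le_drp[OF gw_round_in_cut_vectors, of U r] by (simp add: cut_value_eq_cut_sum)
  qed
  have "drp_value \<P> \<ge> (\<integral>r. (\<integral>W. cut_value (gw_round U r) W \<partial>(Phat' r)) \<partial>sphere_uniform)"
  proof (cases "integrable sphere_uniform (\<lambda>r. \<integral>W. cut_value (gw_round U r) W \<partial>(Phat' r))")
    case True
    then show ?thesis
      by (rule S.integral_le_const) (use upper in \<open>auto simp: space_sphere_uniform\<close>)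
  next
    case False
    \<comment> \<open>The Bochner integral is then \<open>0\<close> by convention.\<close>
    have y: "gw_round U 0 \<in> cut_vectors" by (rule gw_round_in_cut_vectors)
    have "0 \<le> worst (gw_round U 0)"
      unfolding worst_def by (rule cINF_greatest[OF ne]) (use cut_nonneg y in auto)
    then show ?thesis
      using worst_le_drp[OF y] by (simp add: not_integrable_integral_eq[OF False])
  qed
  with lower Phat show ?thesis by blast
qed

end
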